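(* Let $A$ be a totally ordered alphabet and let $w$ be a Lyndon word over $A$. Then the left Lyndon tree $\mathrm{lst}(w)$ and the left Cartesian tree $\mathrm{tl}(w)$ are equal (as complete planar binary trees with leaves labeled by letters, disregarding labels of internal nodes).
   Context: The order $<$ on finite and infinite words is the lexicographical order induced by the order of $A$; for a nonempty finite word $x$, $x^\omega=xxx\cdots$. A nonempty word $w$ is a Lyndon word if for every factorization $w=uv$ with $u,v$ nonempty one has $w<v$. The left standard factorization of a Lyndon word $w$ with $|w|\ge2$ is $w=uv$ with $u$ the longest nonempty proper prefix of $w$ that is a Lyndon word (then $u,v$ are Lyndon). Complete trees: each letter is a tree, and $(\mathfrak t_1,\mathfrak t_2)$ is a tree for trees $\mathfrak t_1,\mathfrak t_2$; foliage $\varphi(a)=a$, $\varphi((\mathfrak t_1,\mathfrak t_2))=\varphi(\mathfrak t_1)\varphi(\mathfrak t_2)$. Left Lyndon tree: $\mathrm{lst}(a)=a$ for a letter, $\mathrm{lst}(w)=(\mathrm{lst}(u),\mathrm{lst}(v))$ for the left standard factorization $w=uv$. Order $\prec$ on nonempty words: $u\prec v$ if $u^\omega<v^\omega$, or $u^\omega=v^\omega$ and $|u|>|v|$. For $w$ of length $n+1$ with nonempty prefixes $p_1,\dots,p_{n+1}=w$ (by increasing length), the prefix standard permutation is the unique $\sigma\in\mathfrak S_{n+1}$ with $p_{\sigma^{-1}(1)}\prec p_{\sigma^{-1}(2)}\prec\cdots\prec p_{\sigma^{-1}(n+1)}$; for a Lyndon word, $\sigma(n+1)=n+1$. Decreasing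 tree of an injective word $\alpha$ over a totally ordered alphabet: the root is the maximal letter $m$ of $\alpha$, and writing $\alpha=u\,m\,v$, its left and right subtrees (possibly empty) are the decreasing trees of $u$ and $v$. Left Cartesian tree: $\mathrm{tl}(a)=a$ for a letter $a$; if $|w|=n+1\ge2$, let $\alpha=\sigma(1)\sigma(2)\cdots\sigma(n)\in\mathfrak S_n$ (the word of $\sigma$ with its last entry $n+1$ removed), let $\mathfrak t^*$ be the decreasing tree of $\alpha$ (a binary tree with $n$ nodes), and let $\mathrm{tl}(w)$ be the complete binary tree whose internal nodes form $\mathfrak t^*$, with leaves (added at every missing child position, $n+1$ of them) labeled by the letters of $w$ from left to right, so that $\varphi(\mathrm{tl}(w))=w$. *)

theory Defs
  imports
    "HOL-Library.List_Lexorder"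
    "HOL-Library.Stream"
    "HOL-Library.Tree"
    "HOL-Combinatorics.Permutations"
begin

text \<open>
  Words over a totally ordered alphabet are lists over a linearly ordered type. Their order is the
  instance of \<^theory>\<open>HOL-Library.List_Lexorder\<close>, in which a proper prefix is the smaller word.
\<close>

definition lyndon :: "'a::linorder list \<Rightarrow> bool" where
  "lyndon w \<longleftrightarrow> w \<noteq> [] \<and> (\<forall>u v. w = u @ v \<and> u \<noteq> [] \<and> v \<noteq> [] \<longrightarrow> w < v)"

datatype 'a ctree = Letter 'a | Branch "'a ctree" "'a ctree"

primrec foliage :: "'a ctree \<Rightarrow> 'a list" where
  "foliage (Letter a) = [a]"
| "foliage (Branch s t) = foliage s @ foliage t"

definition left_std_length :: "'a::linorder list \<Rightarrow> nat" where
  "left_std_length w = Max {length u | u v. w = u @ v \<and> u \<noteq> [] \<and> v \<noteq> [] \<and> lyndon u}"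

lemma lyndon_singleton: "lyndon [a]"
  by (auto simp: lyndon_def append_eq_Cons_conv Cons_eq_append_conv)

lemma left_std_length_bounds:
  assumes "length w \<ge> 2"
  shows "0 < left_std_length w" and "left_std_length w < length w"
proof -
  let ?S = "{length u | u v. w = u @ v \<and> u \<noteq> [] \<and> v \<noteq> [] \<and> lyndon u}"
  from assms obtain a w' where w: "w = [a] @ w'" "w' \<noteq> []"
    by (cases w) (auto simp: numeral_2_eq_2 Suc_le_eq)
  have S: "?S \<subseteq> {0<..<length w}"
    by auto
  moreover from w have "length [a] \<in> ?S"
    using lyndon_singleton by blast
  ultimately have "Max ?S \<in> ?S"
    by (intro Max_in) (auto intro: finite_subset)
  with S have "Max ?S \<in> {0<..<length w}"
    by (rule subsetD)
  then show "0 < left_std_length w" and "left_std_length w < length w"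
    by (simp_all add: left_std_length_def)
qed

text \<open>
  Every word of length at least two has a longest nonempty proper prefix that is Lyndon
  (its first letter is one), so the recursion terminates on all words; only its values on Lyndon
  words are meaningful.
\<close>

function left_lyndon_tree :: "'a::linorder list \<Rightarrow> 'a ctree" where
  "left_lyndon_tree [] = undefined"
| "left_lyndon_tree [a] = Letter a"
| "left_lyndon_tree (a # b # x) =
    (let w = a # b # x; k = left_std_length w
     in Branch (left_lyndon_tree (take k w)) (left_lyndon_tree (drop k w)))"
  by pat_completeness auto
termination
proof (relation "Wellfounded.measure length")
  fix a b :: 'a and x w k
  assume w: "w = a # b # x" and k: "k = left_std_length w"
  have "0 < k" "k < length w"
    using left_std_length_bounds[of w] by (simp_all add: w k)
  then show "(take k w, a # b # x) \<in> Wellfounded.measure length"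
    and "(drop k w, a # b # x) \<in> Wellfounded.measure length"
    by (simp_all add: w)
qed simp

definition stream_less :: "'a::linorder stream \<Rightarrow> 'a stream \<Rightarrow> bool" where
  "stream_less s t \<longleftrightarrow> (\<exists>n. (\<forall>i<n. s !! i = t !! i) \<and> s !! n < t !! n)"

text \<open>For a nonempty word, \<^term>\<open>cycle x\<close> is the infinite word \<open>x\<^sup>\<omega>\<close>.\<close>

definition prec :: "'a::linorder list \<Rightarrow> 'a list \<Rightarrow> bool" where
  "prec u v \<longleftrightarrow> stream_less (cycle u) (cycle v) \<or> (cycle u = cycle v \<and> length u > length v)"

definition is_prefix_std_perm :: "'a::linorder list \<Rightarrow> (nat \<Rightarrow> nat) \<Rightarrow> bool" where
  "is_prefix_std_perm w \<sigma> \<longleftrightarrow>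
     \<sigma> permutes {1..length w} \<and>
     sorted_wrt prec (map (\<lambda>i. take (inv \<sigma> i) w) [1..<Suc (length w)])"

definition prefix_std_perm :: "'a::linorder list \<Rightarrow> nat \<Rightarrow> nat" where
  "prefix_std_perm w = (THE \<sigma>. is_prefix_std_perm w \<sigma>)"

lemma stream_less_irrefl: "\<not> stream_less s s"
  by (auto simp: stream_less_def)

lemma stream_less_trans: "stream_less r s \<Longrightarrow> stream_less s t \<Longrightarrow> stream_less r t"
  unfolding stream_less_def
proof (elim exE conjE)
  fix m n
  assume "\<forall>i<m. r !! i = s !! i" "r !! m < s !! m" "\<forall>i<n. s !! i = t !! i" "s !! n < t !! n"
  then show "\<exists>n. (\<forall>i<n. r !! i = t !! i) \<and> r !! n < t !! n"
    by (intro exI[of _ "min m n"], cases m n rule: linorder_cases) (auto simp: min_def)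
qed

lemma stream_less_total: "s \<noteq> t \<Longrightarrow> stream_less s t \<or> stream_less t s"
proof -
  assume "s \<noteq> t"
  then have ex: "\<exists>n. s !! n \<noteq> t !! n"
    by (metis smap_alt stream.map_ident)
  define n where "n = (LEAST n. s !! n \<noteq> t !! n)"
  have "s !! n \<noteq> t !! n"
    unfolding n_def by (rule LeastI_ex[OF ex])
  moreover have "\<forall>i<n. s !! i = t !! i"
    unfolding n_def using not_less_Least by blast
  ultimately show ?thesis
    unfolding stream_less_def by (metis linorder_neqE)
qed

lemma prec_irrefl: "\<not> prec u u"
  by (auto simp: prec_def stream_less_irrefl)

lemma prec_trans: "prec u v \<Longrightarrow> prec v w \<Longrightarrow> prec u w"
  unfolding prec_def using stream_less_trans by auto

lemma prec_total: "length u \<noteq> length v \<Longrightarrow> prec u v \<or> prec v u"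
  unfolding prec_def using stream_less_total[of "cycle u" "cycle v"]
  by (metis linorder_neqE_nat)

lemma ex1_prefix_std_perm: "\<exists>!\<sigma>. is_prefix_std_perm w \<sigma>"
proof -
  let ?N = "length w"
  let ?I = "{1..?N}"
  define lt where "lt i j \<longleftrightarrow> prec (take i w) (take j w)" for i j
  have lt_irrefl: "\<not> lt i i" for i
    by (simp add: lt_def prec_irrefl)
  have lt_trans: "lt i j \<Longrightarrow> lt j k \<Longrightarrow> lt i k" for i j k
    unfolding lt_def by (rule prec_trans)
  have lt_total: "lt i j \<or> lt j i" if "i \<in> ?I" "j \<in> ?I" "i \<noteq> j" for i j
    unfolding lt_def using that by (intro prec_total) auto
  define R where "R i = card {j \<in> ?I. lt j i} + 1" for i
  define \<rho> where "\<rho> i = (if i \<in> ?I then R i else i)" for i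
  have R_mono: "R i < R j" if "i \<in> ?I" "lt i j" for i j
  proof -
    have "{k \<in> ?I. lt k i} \<subset> {k \<in> ?I. lt k j}"
      using that lt_trans lt_irrefl by blast
    then show ?thesis
      by (simp add: R_def psubset_card_mono)
  qed
  have R_iff: "lt i j \<longleftrightarrow> R i < R j" if "i \<in> ?I" "j \<in> ?I" for i j
    using that R_mono[of i j] R_mono[of j i] lt_total[of i j] lt_irrefl[of i]
    by (metis order_less_asym)
  have inj: "inj_on R ?I"
    using R_mono lt_total by (metis inj_onI less_irrefl)
  have R_in: "R i \<in> ?I" if "i \<in> ?I" for i
  proof -
    have "{k \<in> ?I. lt k i} \<subset> ?I"
      using that lt_irrefl by blast
    then have "card {k \<in> ?I. lt k i} < card ?I"
      by (intro psubset_card_mono) simp_all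
    then show ?thesis
      by (simp add: R_def)
  qed
  have "bij_betw R ?I ?I"
    using inj R_in by (simp add: bij_betw_def endo_inj_surj image_subset_iff)
  then have "bij_betw \<rho> ?I ?I"
    by (rule bij_betw_cong[THEN iffD1, rotated]) (simp add: \<rho>_def)
  then have perm: "\<rho> permutes ?I"
    by (rule bij_imp_permutes) (auto simp: \<rho>_def)
  have char: "is_prefix_std_perm w \<sigma> \<longleftrightarrow>
      \<sigma> permutes ?I \<and> (\<forall>i\<in>?I. \<forall>j\<in>?I. \<sigma> i < \<sigma> j \<longrightarrow> lt i j)" for \<sigma>
  proof (cases "\<sigma> permutes ?I")
    case True
    have "sorted_wrt prec (map (\<lambda>i. take (inv \<sigma> i) w) [1..<Suc ?N]) \<longleftrightarrow>
        (\<forall>k\<in>?I. \<forall>l\<in>?I. k < l \<longrightarrow> lt (inv \<sigma> k) (inv \<sigma> l))" (is "?L \<longleftrightarrow> ?R")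
    proof
      assume L: ?L
      show ?R
      proof (intro ballI impI)
        fix k l assume kl: "k \<in> ?I" "l \<in> ?I" "k < l"
        then have "k - 1 < l - 1" "l - 1 < ?N"
          by auto
        with sorted_wrt_nth_less[OF L, of "k - 1" "l - 1"] kl show "lt (inv \<sigma> k) (inv \<sigma> l)"
          by (simp add: lt_def del: upt_Suc)
      qed
    next
      assume ?R
      then show ?L
        by (auto simp: sorted_wrt_iff_nth_less lt_def simp del: upt_Suc)
    qed
    also have "\<dots> \<longleftrightarrow> (\<forall>i\<in>?I. \<forall>j\<in>?I. \<sigma> i < \<sigma> j \<longrightarrow> lt i j)"
      using permutes_in_image[OF True] permutes_in_image[OF permutes_inv[OF True]]
        permutes_inverses[OF True] by metis
    finally show ?thesis
      using True by (simp add: is_prefix_std_perm_def)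
  qed (simp add: is_prefix_std_perm_def)
  show ?thesis
  proof (rule ex1I)
    show "is_prefix_std_perm w \<rho>"
      unfolding char using perm R_iff by (auto simp: \<rho>_def)
  next
    fix \<sigma> assume "is_prefix_std_perm w \<sigma>"
    then have p: "\<sigma> permutes ?I" and "\<forall>i\<in>?I. \<forall>j\<in>?I. \<sigma> i < \<sigma> j \<longrightarrow> lt i j"
      by (simp_all add: char)
    then have iff: "\<sigma> j < \<sigma> i \<longleftrightarrow> lt j i" if "i \<in> ?I" "j \<in> ?I" for i j
      using that lt_trans lt_irrefl permutes_inj[OF p]
      by (metis injD linorder_less_linear)
    show "\<sigma> = \<rho>"
    proof
      fix i
      show "\<sigma> i = \<rho> i"
      proof (cases "i \<in> ?I")
        case True
        then have i: "\<sigma> i \<in> ?I"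
          using permutes_in_image[OF p] by blast
        have "{j \<in> ?I. lt j i} = {j \<in> ?I. \<sigma> j < \<sigma> i}"
          using iff True by blast
        moreover have "\<sigma> ` {j \<in> ?I. \<sigma> j < \<sigma> i} = {k \<in> ?I. k < \<sigma> i}"
          using permutes_in_image[OF p] permutes_surj[OF p] by (auto simp: image_iff) (metis surjD)
        moreover have "{k \<in> ?I. k < \<sigma> i} = {1..<\<sigma> i}"
          using i by auto
        ultimately have "card {j \<in> ?I. lt j i} = \<sigma> i - 1"
          by (metis (no_types, lifting) card_atLeastLessThan card_image inj_on_subset
              permutes_inj p subset_UNIV)
        then show ?thesis
          using i True by (simp add: \<rho>_def R_def)
      next
        case False
        then show ?thesis
          using permutes_not_in[OF p False] by (simp only: \<rho>_def if_False)
      qed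
    qed
  qed
qed

function decreasing_tree :: "'b::linorder list \<Rightarrow> 'b tree" where
  "decreasing_tree [] = \<langle>\<rangle>"
| "decreasing_tree (x # xs) =
    (let m = Max (set (x # xs)) in
      \<langle>decreasing_tree (takeWhile (\<lambda>y. y \<noteq> m) (x # xs)), m,
       decreasing_tree (tl (dropWhile (\<lambda>y. y \<noteq> m) (x # xs)))\<rangle>)"
  by pat_completeness auto

lemma split_at_Max:
  assumes "xs \<noteq> []" and "m = Max (set xs)"
  shows "takeWhile (\<lambda>y. y \<noteq> m) xs @ m # tl (dropWhile (\<lambda>y. y \<noteq> m) xs) = xs"
proof -
  have "m \<in> set xs"
    using assms by simp
  then have "dropWhile (\<lambda>y. y \<noteq> m) xs \<noteq> []"
    by (auto simp: dropWhile_eq_Nil_conv)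
  then have "dropWhile (\<lambda>y. y \<noteq> m) xs = m # tl (dropWhile (\<lambda>y. y \<noteq> m) xs)"
    using hd_dropWhile by (metis (mono_tags) list.collapse)
  then show ?thesis
    by (metis takeWhile_dropWhile_id)
qed

termination decreasing_tree
proof (relation "Wellfounded.measure length")
  fix x m :: "'b::linorder" and xs
  assume "m = Max (set (x # xs))"
  from arg_cong[OF split_at_Max[OF _ this], of length]
  show "(takeWhile (\<lambda>y. y \<noteq> m) (x # xs), x # xs) \<in> Wellfounded.measure length"
    and "(tl (dropWhile (\<lambda>y. y \<noteq> m) (x # xs)), x # xs) \<in> Wellfounded.measure length"
    by (simp_all del: takeWhile.simps dropWhile.simps)
qed simp

text \<open>
  Add a leaf at every missing child position of a binary tree and label the leaves from left to
  right by a word whose length is the number \<^term>\<open>size1 t\<close> of these positions.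
\<close>

primrec complete_with :: "'b tree \<Rightarrow> 'a list \<Rightarrow> 'a ctree" where
  "complete_with \<langle>\<rangle> w = Letter (hd w)"
| "complete_with \<langle>l, m, r\<rangle> w =
    Branch (complete_with l (take (size1 l) w)) (complete_with r (drop (size1 l) w))"

definition left_cartesian_tree :: "'a::linorder list \<Rightarrow> 'a ctree" where
  "left_cartesian_tree w =
    (if length w = 1 then Letter (hd w)
     else complete_with (decreasing_tree (map (prefix_std_perm w) [1..<length w])) w)"

lemma foliage_complete_with: "length w = size1 t \<Longrightarrow> foliage (complete_with t w) = w"
proof (induction t arbitrary: w)
  case Leaf
  then show ?case
    by (cases w) auto
qed simp

lemma inorder_decreasing_tree: "inorder (decreasing_tree xs) = xs"
proof (induction xs rule: decreasing_tree.induct)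
  case (2 x xs)
  then show ?case
    using split_at_Max[of "x # xs"]
    by (simp add: Let_def del: takeWhile.simps dropWhile.simps)
qed simp

lemma foliage_left_cartesian_tree:
  assumes "w \<noteq> []"
  shows "foliage (left_cartesian_tree w) = w"
proof -
  have "size1 (decreasing_tree xs) = length xs + 1" for xs :: "nat list"
    by (metis inorder_decreasing_tree length_inorder size1_size)
  with assms show ?thesis
    by (cases w) (auto simp: left_cartesian_tree_def simp del: upt_Suc intro!: foliage_complete_with)
qed

end

theory Submission
  imports Defs
begin

text \<open>
  For nonempty words, \<open>x\<^sup>\<omega> < y\<^sup>\<omega>\<close> iff \<open>xy < yx\<close>. Hence a prefix \<open>x\<close> of \<open>xs\<close> precedes \<open>xs\<close> iff
  \<open>xs < sx\<close>, so the Lyndon prefixes of \<open>w\<close> are exactly the left-to-right maxima of the sequence of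
  prefixes with respect to \<open>\<prec>\<close>, and the greatest proper prefix is the longest Lyndon one, \<open>u\<close>. Writing
  \<open>w = uv\<close>, maximality of \<open>u\<close> forces \<open>v = xc\<close> with \<open>xb\<close> a prefix of \<open>w\<close> and \<open>b < c\<close>. In particular
  \<open>w\<close> without its last letter has period \<open>|u|\<close>, from which one sees that \<open>v\<close> is Lyndon and that
  prefixing \<open>u\<close> does not change the order \<open>\<prec>\<close> of the proper prefixes of \<open>v\<close>. So the two trees have
  the same recursive structure.
\<close>

section \<open>Lexicographic order\<close>

lemma append_less_append_iff: "x @ a < x @ b \<longleftrightarrow> a < (b :: 'a::linorder list)"
  by (induction x) auto

text \<open>The length bound rules out that \<open>xs\<close> is a proper prefix of
  \<open>ys\<close>, so the order is decided at a letter.\<close>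

lemma less_first_difference:
  fixes xs ys :: "'a::linorder list"
  assumes "xs < ys" and "length ys \<le> length xs"
  shows "\<exists>x b c y z. xs = x @ b # y \<and> ys = x @ c # z \<and> b < c"
  using assms
proof (induction xs arbitrary: ys)
  case (Cons a xs)
  then obtain d zs where ys: "ys = d # zs"
    by (cases ys) auto
  show ?case
  proof (cases "a < d")
    case True
    then show ?thesis
      unfolding ys by (metis append_Nil)
  next
    case False
    with Cons.prems have "a = d" "xs < zs" "length zs \<le> length xs"
      by (auto simp: ys)
    with Cons.IH[of zs] show ?thesis
      unfolding ys by (metis append_Cons)
  qed
qed auto

lemma less_append:
  fixes xs ys :: "'a::linorder list"
  assumes "xs < ys" and "length ys \<le> length xs"
  shows "xs @ a < ys @ b"
  using less_first_difference[OF assms] by (auto simp: append_less_append_iff)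

lemma less_appendI: "xs < ys \<Longrightarrow> xs < ys @ (zs :: 'a::linorder list)"
proof (induction xs arbitrary: ys)
  case Nil
  then show ?case
    by (cases ys) auto
next
  case (Cons a xs)
  then show ?case
    by (cases ys) auto
qed

lemma not_append_less: "\<not> xs @ ys < (xs :: 'a::linorder list)"
  by (induction xs) auto

section \<open>Comparison of infinite powers\<close>

abbreviation word_power :: "nat \<Rightarrow> 'a list \<Rightarrow> 'a list" where
  "word_power n x \<equiv> concat (replicate n x)"

lemma length_word_power: "length (word_power n x) = n * length x"
  by (induction n) auto

lemma cycle_word_power: "x \<noteq> [] \<Longrightarrow> cycle x = word_power n x @- cycle x"
proof (induction n)
  case (Suc n)
  then show ?case
    using cycle_decomp[of x] by simp
qed simp

text \<open>Moving \<open>y\<close> to the left past the copies of \<open>x\<close>, one at a time,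
  increases the word at each step.\<close>

lemma word_power_swap_less:
  fixes x y :: "'a::linorder list"
  assumes "x @ y < y @ x" and "n > 0"
  shows "word_power n x @ y < y @ word_power n x"
  using assms(2)
proof (induction n rule: nat_induct_non_zero)
  case 1
  with assms show ?case by simp
next
  case (Suc n)
  have "x @ word_power n x @ y < x @ y @ word_power n x"
    using Suc by (simp add: append_less_append_iff)
  also have "\<dots> < y @ x @ word_power n x"
    using less_append[OF assms(1), of "word_power n x" "word_power n x"] by simp
  finally show ?case by simp
qed

lemma word_power_swap_greater:
  fixes x y :: "'a::linorder list"
  assumes "x @ y < y @ x" and "n > 0"
  shows "x @ word_power n y < word_power n y @ x"
  using assms(2)
proof (induction n rule: nat_induct_non_zero)
  case 1
  with assms show ?case by simp
next
  case (Suc n)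
  have "x @ y @ word_power n y < y @ x @ word_power n y"
    using less_append[OF assms(1), of "word_power n y" "word_power n y"] by simp
  also have "\<dots> < y @ word_power n y @ x"
    using Suc by (simp add: append_less_append_iff)
  finally show ?case by simp
qed

lemma word_power_commute:
  assumes "x @ y = y @ x"
  shows "word_power n x @ y = y @ word_power n x"
proof (induction n)
  case (Suc n)
  have "word_power (Suc n) x @ y = x @ y @ word_power n x"
    using Suc by simp
  also have "\<dots> = (x @ y) @ word_power n x"
    by (simp only: append.assoc)
  also have "\<dots> = y @ word_power (Suc n) x"
    unfolding assms by simp
  finally show ?case .
qed simp

lemma stream_less_shift:
  fixes xs ys :: "'a::linorder list"
  assumes "xs < ys" and "length xs = length ys"
  shows "stream_less (xs @- s) (ys @- t)"
proof -
  obtain x b c y z where "xs = x @ b # y" "ys = x @ c # z" "b < c"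
    using less_first_difference[of xs ys] assms by auto
  then show ?thesis
    unfolding stream_less_def by (intro exI[of _ "length x"]) (auto simp: shift_snth)
qed

text \<open>The equation \<open>s = p @- s\<close> fixes the first \<open>length p\<close> letters
  and copies each later one from \<open>length p\<close> places before.\<close>

lemma shift_fixpoint_unique:
  assumes "p \<noteq> []" and "s = p @- s" and "t = p @- t"
  shows "s = t"
proof -
  have "s !! i = t !! i" for i
  proof (induction i rule: less_induct)
    case (less i)
    show ?case
    proof (cases "i < length p")
      case True
      then show ?thesis
        using assms(2,3) by (metis shift_snth_less)
    next
      case False
      moreover have "length p > 0"
        using assms(1) by simp
      ultimately have "s !! (i - length p) = t !! (i - length p)"
        by (intro less) linarith
      then show ?thesis
        using False assms(2,3) by (metis not_less shift_snth_ge)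
    qed
  qed
  then show ?thesis
    by (metis smap_alt stream.map_ident)
qed

text \<open>Both words are replaced by powers of the same length, which are prefixes of the two
  infinite words. For words of equal length, \<open>p @ q < q @ p\<close> forces
  \<open>p < q\<close>.\<close>

lemma cycle_less:
  fixes x y :: "'a::linorder list"
  assumes "x \<noteq> []" and "y \<noteq> []" and "x @ y < y @ x"
  shows "stream_less (cycle x) (cycle y)"
proof -
  define p q where "p = word_power (length y) x" and "q = word_power (length x) y"
  have len: "length p = length q"
    by (simp add: p_def q_def length_word_power)
  have "p @ y < y @ p"
    unfolding p_def using assms by (intro word_power_swap_less) auto
  then have "p @ q < q @ p"
    unfolding q_def using assms by (intro word_power_swap_greater) auto
  then have "p < q"
    using len less_append[of q p p q] by (metis less_asym linorder_neqE order.order_iff_strict)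
  then show ?thesis
    using stream_less_shift[OF _ len] cycle_word_power[OF assms(1), of "length y"]
      cycle_word_power[OF assms(2), of "length x"]
    unfolding p_def q_def by metis
qed

lemma cycle_eq:
  assumes "x \<noteq> []" and "y \<noteq> []" and "x @ y = y @ x"
  shows "cycle x = cycle y"
proof -
  define p q where "p = word_power (length y) x" and "q = word_power (length x) y"
  have len: "length p = length q"
    by (simp add: p_def q_def length_word_power)
  have "p @ y = y @ p"
    unfolding p_def using assms(3) by (rule word_power_commute)
  then have "q @ p = p @ q"
    unfolding q_def by (intro word_power_commute) (rule sym)
  with len have "p = q"
    by (metis append_eq_append_conv)
  moreover have "p \<noteq> []"
    using assms(1,2) by (auto simp: p_def)
  ultimately show ?thesis
    using shift_fixpoint_unique cycle_word_power[OF assms(1), of "length y"]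
      cycle_word_power[OF assms(2), of "length x"]
    unfolding p_def q_def by metis
qed

text \<open>Cancelling the common prefix \<open>x\<close> reduces the pair \<open>x\<close>,
  \<open>x @ s\<close> to the pair \<open>x\<close>, \<open>s\<close>. The three cases exclude each
  other, so the one-sided \<open>cycle_less\<close> is enough for an equivalence.\<close>

lemma prec_append_iff:
  fixes x s :: "'a::linorder list"
  assumes "x \<noteq> []" and "s \<noteq> []"
  shows "prec x (x @ s) \<longleftrightarrow> x @ s < s @ x"
proof -
  have *: "x @ (x @ s) < (x @ s) @ x \<longleftrightarrow> x @ s < s @ x"
    "(x @ s) @ x < x @ (x @ s) \<longleftrightarrow> s @ x < x @ s"
    by (simp_all add: append_less_append_iff)
  consider "x @ s < s @ x" | "s @ x < x @ s" | "x @ s = s @ x"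
    by fastforce
  then show ?thesis
  proof cases
    case 1
    then show ?thesis
      using cycle_less[of x "x @ s"] assms * by (auto simp: prec_def)
  next
    case 2
    then have "stream_less (cycle (x @ s)) (cycle x)"
      using cycle_less[of "x @ s" x] assms * by simp
    then show ?thesis
      using 2 stream_less_trans stream_less_irrefl assms unfolding prec_def
      by (metis less_asym)
  next
    case 3
    then have "cycle x = cycle (x @ s)"
      using assms by (intro cycle_eq) auto
    \<comment> \<open>With equal infinite powers the longer word precedes, so both sides are
      false.\<close>
    then show ?thesis
      using 3 assms stream_less_irrefl unfolding prec_def by auto
  qed
qed

section \<open>Lyndon words\<close>

lemma lyndonD: "lyndon (u @ v) \<Longrightarrow> u \<noteq> [] \<Longrightarrow> v \<noteq> [] \<Longrightarrow> u @ v < v"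
  by (auto simp: lyndon_def)

lemma lyndon_less_rotation:
  "lyndon (u @ v) \<Longrightarrow> u \<noteq> [] \<Longrightarrow> v \<noteq> [] \<Longrightarrow> u @ v < v @ u"
  by (blast intro: less_appendI lyndonD)

text \<open>The suffix \<open>v\<close> is compared with the prefix of the same length. If
  \<open>v\<close> is smaller, then so is the rotation \<open>v @ u\<close>, a contradiction;
  equality needs two rotations.\<close>

lemma lyndon_rotationI:
  fixes w :: "'a::linorder list"
  assumes "w \<noteq> []" and rot: "\<And>u v. w = u @ v \<Longrightarrow> u \<noteq> [] \<Longrightarrow> v \<noteq> [] \<Longrightarrow> w < v @ u"
  shows "lyndon w"
  unfolding lyndon_def
proof (intro conjI allI impI)
  fix u v assume w: "w = u @ v \<and> u \<noteq> [] \<and> v \<noteq> []"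
  define p q where "p = take (length v) w" and "q = drop (length v) w"
  have pq: "w = p @ q"
    by (simp only: p_def q_def append_take_drop_id)
  have lp: "length p = length v" and lq: "length q = length u"
    using w by (simp_all add: p_def q_def)
  consider "p < v" | "v < p" | "p = v"
    by fastforce
  then show "w < v"
  proof cases
    case 1
    then show ?thesis
      using less_append[of p v q "[]"] lp pq by simp
  next
    case 2
    then have "v @ u < w"
      using less_append[of v p u q] lp pq by simp
    with rot[of u v] w show ?thesis by auto
  next
    \<comment> \<open>Rotating at \<open>u\<close> gives \<open>q < u\<close>, rotating at
      \<open>v\<close> gives \<open>u @ v < q @ v\<close>; these clash because \<open>q\<close> and
      \<open>u\<close> have equal length.\<close>
    case 3
    moreover have "q \<noteq> []"
      using lq w by (metis length_0_conv)
    ultimately have "w < v @ u" "w = v @ q" "w < q @ v"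
      using rot[of u v] rot[of v q] w pq by auto
    then have "q < u"
      by (simp add: append_less_append_iff)
    then have "q @ v < u @ v"
      using lq by (intro less_append) auto
    with \<open>w < q @ v\<close> w show ?thesis by auto
  qed
qed fact

text \<open>This is what contradicts the maximality of \<open>u\<close> later. A suffix
  \<open>r\<close> below the prefix of its length would give the long word a smaller suffix, so only
  a suffix that is also a prefix is critical; it contradicts \<open>b < c\<close> or the Lyndon
  property of \<open>u\<close>.\<close>

lemma lyndon_extend:
  fixes u x :: "'a::linorder list"
  assumes lw: "lyndon (u @ x @ c # v)" and lu: "lyndon u"
    and w: "u @ x @ c # v = x @ b # z" and bc: "b < c"
  shows "lyndon (u @ x @ [c])"
  unfolding lyndon_def
proof (intro conjI allI impI)
  fix p r assume pr: "u @ x @ [c] = p @ r \<and> p \<noteq> [] \<and> r \<noteq> []"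
  define q where "q = u @ x @ [c]"
  define q1 q2 where "q1 = take (length r) q" and "q2 = drop (length r) q"
  have q: "q = q1 @ q2"
    by (simp only: q1_def q2_def append_take_drop_id)
  have len: "length q1 = length r"
    using pr by (simp add: q1_def q_def)
  have w_q: "u @ x @ c # v = q @ v"
    by (simp add: q_def)
  consider "q1 < r" | "r < q1" | "q1 = r"
    by fastforce
  then show "u @ x @ [c] < r"
  proof cases
    case 1
    then show ?thesis
      using less_append[of q1 r q2 "[]"] q len by (simp add: q_def)
  next
    case 2
    have "p @ (r @ v) < r @ v"
      using lw pr w_q q_def by (intro lyndonD) auto
    moreover have "r @ v < q1 @ q2 @ v"
      using 2 len by (intro less_append) auto
    ultimately show ?thesis
      using q pr q_def by (metis append.assoc less_asym)
  next
    case 3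
    then have wr: "x @ b # z = r @ q2 @ v"
      using w w_q q by simp
    from pr have "(\<exists>u'. u = p @ u' \<and> r = u' @ x @ [c]) \<or> (\<exists>p'. p = u @ p' \<and> x @ [c] = p' @ r)"
      unfolding append_eq_append_conv2 by metis
    then consider p' where "p = u @ p'" "x @ [c] = p' @ r"
      | u' where "u = p @ u'" "r = u' @ x @ [c]" "u' \<noteq> []"
      by (metis append_Nil append_Nil2)
    then have False
    proof cases
      case 1
      then obtain r' where r': "r = r' @ [c]" "x = p' @ r'"
        using pr by (metis append_is_Nil_conv butlast_append butlast_snoc last_appendR last_snoc
            append_butlast_last_id)
      show False
      proof (cases "p' = []")
        case True
        then show False using wr r' bc by auto
      next
        case False
        have "p' @ (r' @ b # z) < r' @ b # z"
          using lw[unfolded w] r' False by (intro lyndonD) auto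
        \<comment> \<open>The whole word also starts with \<open>r = r' @ [c]\<close>, so its suffix
          \<open>r' @ b # z\<close> would be smaller than it.\<close>
        moreover have "p' @ (r' @ b # z) = r' @ c # q2 @ v"
          using wr r' by simp
        ultimately show False
          using bc by (auto simp: append_less_append_iff)
      qed
    next
      case 2
      have "u @ x @ c # v = u' @ x @ c # q2 @ v"
        using w wr 2 by simp
      moreover have "length u' \<le> length u"
        using 2 by simp
      \<comment> \<open>Now \<open>u'\<close> is a prefix and a proper suffix of the Lyndon word
        \<open>u\<close>: a proper suffix exceeds \<open>u\<close>, a prefix does not.\<close>
      ultimately obtain u'' where "u = u' @ u''"
        by (auto simp: append_eq_append_conv2)
      then show False
        using lyndonD[of p u'] lu 2 pr not_append_less by metis
    qed
    then show ?thesis ..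
  qed
qed simp

text \<open>The suffix \<open>v\<close> exceeds \<open>u @ v\<close>, which yields a first
  difference. By \<open>lyndon_extend\<close> the prefix \<open>u @ x @ [c]\<close> is Lyndon, hence
  by maximality not a proper prefix.\<close>

lemma left_standard_shape:
  fixes u v :: "'a::linorder list"
  assumes lw: "lyndon (u @ v)" and lu: "lyndon u" and v: "v \<noteq> []"
    and max: "\<And>y z. v = y @ z \<Longrightarrow> y \<noteq> [] \<Longrightarrow> z \<noteq> [] \<Longrightarrow> \<not> lyndon (u @ y)"
  obtains x b c z where "v = x @ [c]" and "u @ v = x @ b # z" and "b < c"
proof -
  have "u \<noteq> []"
    using lu by (simp add: lyndon_def)
  then have "\<exists>x b c y z. u @ v = x @ b # y \<and> v = x @ c # z \<and> b < c"
    using lw v by (intro less_first_difference lyndonD) auto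
  then obtain x b c y z where xy: "u @ v = x @ b # z" "v = x @ c # y" "b < c"
    by blast
  then have "lyndon (u @ x @ [c])"
    using lw lu by (intro lyndon_extend[of u x c y b z]) auto
  then have "y = []"
    using max[of "x @ [c]" y] xy by auto
  with xy that show thesis by auto
qed

text \<open>A proper suffix \<open>r' @ [c]\<close> exceeds \<open>r' @ [b]\<close>, which begins a
  suffix of \<open>w\<close> and so is not below the prefix of \<open>w\<close> of its length.
  Together with \<open>left_standard_shape\<close> this makes the right factor Lyndon.\<close>

lemma lyndon_right_factor:
  fixes w x :: "'a::linorder list"
  assumes lw: "lyndon w" and w: "w = x @ b # z" and bc: "b < c"
  shows "lyndon (x @ [c])"
  unfolding lyndon_def
proof (intro conjI allI impI)
  fix p r assume pr: "x @ [c] = p @ r \<and> p \<noteq> [] \<and> r \<noteq> []"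
  then obtain r' where r': "r = r' @ [c]" "x = p @ r'"
    by (metis append_is_Nil_conv butlast_append butlast_snoc last_appendR last_snoc
        append_butlast_last_id)
  define q1 q2 where "q1 = take (length r) x" and "q2 = drop (length r) x"
  have x: "x = q1 @ q2"
    by (simp only: q1_def q2_def append_take_drop_id)
  have "length r \<le> length x"
    using r' pr by (cases p) auto
  then have len: "length q1 = length r"
    by (simp add: q1_def)
  have "w = p @ r' @ b # z"
    using w r'(2) by simp
  then have "w < (r' @ [b]) @ z"
    using lyndonD[of p "r' @ b # z"] lw pr by simp
  moreover have "w = q1 @ (q2 @ b # z)"
    using w x by simp
  ultimately have w_less: "q1 @ (q2 @ b # z) < (r' @ [b]) @ z"
    by (simp only:)
  have "\<not> r' @ [b] < q1"
    using less_append[of "r' @ [b]" q1 z "q2 @ b # z"] w_less len r' by auto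
  moreover have "r' @ [b] < r"
    using r' bc by (simp add: append_less_append_iff)
  ultimately have "q1 < r"
    by (meson not_less order.strict_trans1)
  then show "x @ [c] < r"
    using less_append[of q1 r "q2 @ [c]" "[]"] len x by simp
qed simp

text \<open>The two factorizations give \<open>u @ y @ s\<close> the period \<open>length u\<close>,
  so \<open>y @ s @ a\<close> is compared with \<open>s @ y @ d\<close>. The first parts decide
  unless they agree; only that tie uses the Lyndon property.\<close>

lemma rotation_less_shift_iff:
  fixes u y s :: "'a::linorder list"
  assumes lw: "lyndon (u @ y @ s @ t)" and w: "u @ y @ s @ t = y @ s @ t'"
    and u: "u \<noteq> []" and s: "s \<noteq> []"
  shows "(u @ y) @ s < s @ (u @ y) \<longleftrightarrow> y @ s < s @ y"
proof -
  define a where "a = take (length u) t'"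
  have a: "u @ y @ s = y @ s @ a"
    using arg_cong[OF w, of "take (length (u @ y @ s))"] by (simp add: a_def)
  have la: "length a = length u"
    using arg_cong[OF a, of length] by simp
  define d where "d = take (length u) (s @ a)"
  have d: "u @ y = y @ d"
    using arg_cong[OF a, of "take (length (u @ y))"] by (simp add: d_def)
  consider "y @ s < s @ y" | "s @ y < y @ s" | "y @ s = s @ y"
    by fastforce
  then show ?thesis
  proof cases
    case 1
    then have "u @ y @ s < s @ u @ y"
      using less_append[of "y @ s" "s @ y" a d] unfolding a d by simp
    with 1 show ?thesis by simp
  next
    case 2
    then have "s @ u @ y < u @ y @ s"
      using less_append[of "s @ y" "y @ s" d a] a d by simp
    with 2 show ?thesis by auto
  next
    \<comment> \<open>In the tie, cancelling \<open>s\<close> leaves \<open>y @ a\<close> against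
      \<open>u @ y\<close>. As \<open>y @ a @ t\<close> is a proper suffix of the Lyndon word,
      \<open>y @ a\<close> cannot be the smaller one.\<close>
    case 3
    then have sa: "u @ y @ s = s @ y @ a"
      using a by (metis append.assoc)
    then have sat: "u @ y @ s @ t = s @ y @ a @ t"
      by (metis append.assoc)
    have "a \<noteq> []"
      using u la by auto
    then have "u @ y @ s @ t < y @ a @ t"
      using lyndonD[of s "y @ a @ t"] lw s unfolding sat by simp
    then have "\<not> y @ a < u @ y"
      using less_append[of "y @ a" "u @ y" t "s @ t"] la by auto
    then have "\<not> s @ y @ a < s @ u @ y"
      by (simp add: append_less_append_iff)
    with 3 sa show ?thesis by simp
  qed
qed

section \<open>Decreasing trees\<close>

lemma size1_decreasing_tree: "size1 (decreasing_tree xs) = length xs + 1"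
  by (metis inorder_decreasing_tree length_inorder size1_size)

lemma decreasing_tree_split:
  assumes "\<And>y. y \<in> set l \<union> set r \<Longrightarrow> y < m"
  shows "decreasing_tree (l @ m # r) = \<langle>decreasing_tree l, m, decreasing_tree r\<rangle>"
proof -
  obtain x xs where xs: "l @ m # r = x # xs"
    by (cases l) auto
  have max: "Max (set (l @ m # r)) = m"
    using assms by (intro Max_eqI) (auto intro: order.strict_implies_order)
  have "y \<noteq> m" if "y \<in> set l" for y
    using assms that by blast
  then have "takeWhile (\<lambda>y. y \<noteq> m) (l @ m # r) = l"
    "dropWhile (\<lambda>y. y \<noteq> m) (l @ m # r) = m # r"
    by (simp_all add: takeWhile_append dropWhile_append)
  then show ?thesis
    using max unfolding xs by (simp add: Let_def del: takeWhile.simps dropWhile.simps)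
qed

section \<open>The two trees\<close>

lemma left_std_length_props:
  fixes w :: "'a::linorder list"
  assumes "length w \<ge> 2"
  shows "lyndon (take (left_std_length w) w)"
    and "left_std_length w < k \<Longrightarrow> k < length w \<Longrightarrow> \<not> lyndon (take k w)"
proof -
  let ?S = "{length u | u v. w = u @ v \<and> u \<noteq> [] \<and> v \<noteq> [] \<and> lyndon u}"
  have fin: "finite ?S"
    by (rule finite_subset[of _ "{..length w}"]) auto
  obtain a w' where "w = [a] @ w'" "w' \<noteq> []"
    using assms by (cases w) (auto simp: numeral_2_eq_2 Suc_le_eq)
  then have "length [a] \<in> ?S"
    using lyndon_singleton by blast
  with fin have "Max ?S \<in> ?S"
    by (intro Max_in) auto
  then show "lyndon (take (left_std_length w) w)"
    unfolding left_std_length_def[symmetric] by auto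
  show "\<not> lyndon (take k w)" if "left_std_length w < k" "k < length w"
  proof
    assume "lyndon (take k w)"
    then have "length (take k w) \<in> ?S"
      using that by (intro CollectI exI[of _ "take k w"] exI[of _ "drop k w"]) auto
    then have "k \<in> ?S"
      using that by simp
    then have "k \<le> left_std_length w"
      unfolding left_std_length_def using fin by (rule Max_ge[rotated])
    with that show False by simp
  qed
qed

lemma left_lyndon_tree_Branch:
  assumes "length w \<ge> 2"
  shows "left_lyndon_tree w = Branch (left_lyndon_tree (take (left_std_length w) w))
    (left_lyndon_tree (drop (left_std_length w) w))"
  using assms by (cases w rule: left_lyndon_tree.cases) (simp_all add: Let_def)

text \<open>
  Only the relative order of the entries of \<open>xs\<close> matters for the shape of its decreasing tree;
  entry \<open>i\<close> stands for the prefix of length \<open>i + 1\<close>.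
\<close>

definition represents_prefix_order :: "nat list \<Rightarrow> 'a::linorder list \<Rightarrow> bool" where
  "represents_prefix_order xs w \<longleftrightarrow> distinct xs \<and> length w = Suc (length xs) \<and>
    (\<forall>y s t. w = y @ s @ t \<and> y \<noteq> [] \<and> s \<noteq> [] \<and> t \<noteq> [] \<longrightarrow>
      (xs ! (length y - 1) < xs ! (length (y @ s) - 1) \<longleftrightarrow> y @ s < s @ y))"

lemma represents_prefix_orderD:
  assumes "represents_prefix_order xs w" and "w = y @ s @ t" and "y \<noteq> []" "s \<noteq> []" "t \<noteq> []"
  shows "xs ! (length y - 1) < xs ! (length (y @ s) - 1) \<longleftrightarrow> y @ s < s @ y"
  using assms unfolding represents_prefix_order_def by blast

lemma represents_prefix_order_less_iff:
  assumes rep: "represents_prefix_order xs w" and "i < j" "j < length xs"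
  shows "xs ! i < xs ! j \<longleftrightarrow>
    take (Suc j) w < drop (Suc i) (take (Suc j) w) @ take (Suc i) w"
proof -
  have len: "length w = Suc (length xs)"
    using rep by (simp add: represents_prefix_order_def)
  define y s t where "y = take (Suc i) w" and "s = drop (Suc i) (take (Suc j) w)"
    and "t = drop (Suc j) w"
  have ys: "y @ s = take (Suc j) w"
    using append_take_drop_id[of "Suc i" "take (Suc j) w"] assms(2)
    by (simp add: y_def s_def min_def)
  then have "w = y @ s @ t"
    by (metis append.assoc append_take_drop_id t_def)
  moreover have "y \<noteq> []" "s \<noteq> []" "t \<noteq> []"
    using assms len by (auto simp: y_def s_def t_def)
  ultimately have "xs ! (length y - 1) < xs ! (length (y @ s) - 1) \<longleftrightarrow> y @ s < s @ y"
    by (rule represents_prefix_orderD[OF rep])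
  then show ?thesis
    using assms len unfolding ys by (simp add: y_def s_def)
qed

text \<open>For each \<open>i\<close>, the inequality of the entries says that the prefix is below
  its rotation by \<open>Suc i\<close> letters, and being Lyndon means being below all nontrivial
  rotations.\<close>

lemma lyndon_prefix_iff_left_to_right_maximum:
  assumes rep: "represents_prefix_order xs w" and j: "j < length xs"
  shows "lyndon (take (Suc j) w) \<longleftrightarrow> (\<forall>i<j. xs ! i < xs ! j)"
proof
  have len: "length w = Suc (length xs)"
    using rep by (simp add: represents_prefix_order_def)
  let ?p = "take (Suc j) w"
  {
    assume l: "lyndon ?p"
    show "\<forall>i<j. xs ! i < xs ! j"
    proof (intro allI impI)
      fix i assume i: "i < j"
      have "?p = take (Suc i) w @ drop (Suc i) ?p"
        using append_take_drop_id[of "Suc i" ?p] i by (simp add: min_def)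
      then have "?p < drop (Suc i) ?p @ take (Suc i) w"
        using lyndon_less_rotation[of "take (Suc i) w" "drop (Suc i) ?p"] l i j len by force
      then show "xs ! i < xs ! j"
        using represents_prefix_order_less_iff[OF rep i j] by simp
    qed
  next
    assume m: "\<forall>i<j. xs ! i < xs ! j"
    show "lyndon ?p"
    proof (rule lyndon_rotationI)
      show "?p \<noteq> []"
        using len by auto
      fix u v assume uv: "?p = u @ v" "u \<noteq> []" "v \<noteq> []"
      define i where "i = length u - 1"
      have lp: "length u + length v = Suc j"
        using arg_cong[OF uv(1), of length] j len by simp
      then have i: "i < j" "Suc i = length u"
        using uv(2,3) by (auto simp: i_def Suc_le_eq simp flip: length_greater_0_conv)
      then have "take (Suc i) ?p = take (Suc i) w"
        by (simp add: min_def)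
      then have "take (Suc i) w = u" "drop (Suc i) ?p = v"
        using uv(1) i(2) by simp_all
      then show "?p < v @ u"
        using m i represents_prefix_order_less_iff[OF rep i(1) j] by simp
    qed
  }
qed

lemma represents_prefix_order_left:
  assumes rep: "represents_prefix_order (xs @ m # ys) (u @ v)" and len: "length u = Suc (length xs)"
  shows "represents_prefix_order xs u"
  unfolding represents_prefix_order_def
proof (intro conjI allI impI)
  show "distinct xs" "length u = Suc (length xs)"
    using rep len by (auto simp: represents_prefix_order_def)
  fix y s t assume u: "u = y @ s @ t \<and> y \<noteq> [] \<and> s \<noteq> [] \<and> t \<noteq> []"
  then have "length (y @ s) - 1 < length xs" "length y - 1 < length xs"
    using len by (auto simp: Suc_le_eq simp flip: length_greater_0_conv)
  then show "xs ! (length y - 1) < xs ! (length (y @ s) - 1) \<longleftrightarrow> y @ s < s @ y"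
    using represents_prefix_orderD[OF rep, of y s "t @ v"] u by (simp add: nth_append)
qed

text \<open>The prefix \<open>y\<close> of the right factor corresponds to the prefix
  \<open>u @ y\<close> of the whole word; \<open>rotation_less_shift_iff\<close> says that inserting
  \<open>u\<close> leaves the comparisons unchanged.\<close>

lemma represents_prefix_order_right:
  fixes u x :: "'a::linorder list"
  assumes rep: "represents_prefix_order (xs @ m # ys) (u @ x @ [c])"
    and len: "length u = Suc (length xs)"
    and lw: "lyndon (u @ x @ [c])" and w: "u @ x @ [c] = x @ z"
  shows "represents_prefix_order ys (x @ [c])"
  unfolding represents_prefix_order_def
proof (intro conjI allI impI)
  show "distinct ys" "length (x @ [c]) = Suc (length ys)"
    using rep len by (auto simp: represents_prefix_order_def)
  fix y s t assume v: "x @ [c] = y @ s @ t \<and> y \<noteq> [] \<and> s \<noteq> [] \<and> t \<noteq> []"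
  \<comment> \<open>The nonempty \<open>t\<close> ends in \<open>c\<close>, so \<open>y @ s\<close>
    is a prefix of \<open>x\<close> and therefore also of the whole word.\<close>
  then have x: "x = y @ s @ butlast t"
    by (metis append.assoc append_is_Nil_conv butlast_append butlast_snoc)
  have "(u @ y) @ s < s @ (u @ y) \<longleftrightarrow> y @ s < s @ y"
    using lw w v x len by (intro rotation_less_shift_iff[of _ _ _ t "butlast t @ z"]) auto
  moreover have "(xs @ m # ys) ! (length (u @ y) - 1) < (xs @ m # ys) ! (length ((u @ y) @ s) - 1)
      \<longleftrightarrow> (u @ y) @ s < s @ (u @ y)"
    using v len by (intro represents_prefix_orderD[OF rep]) auto
  \<comment> \<open>The offset \<open>length u\<close> skips the entries of \<open>xs\<close> and
    \<open>m\<close>.\<close>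
  moreover have "(xs @ m # ys) ! (length (u @ y @ a) - 1) = ys ! (length (y @ a) - 1)" for a
    using len v by (cases "length y") (auto simp: nth_append)
  from this[of "[]"] this[of s]
  have "(xs @ m # ys) ! (length (u @ y) - 1) = ys ! (length y - 1)"
    "(xs @ m # ys) ! (length ((u @ y) @ s) - 1) = ys ! (length (y @ s) - 1)"
    by simp_all
  ultimately show "ys ! (length y - 1) < ys ! (length (y @ s) - 1) \<longleftrightarrow> y @ s < s @ y"
    by simp
qed

text \<open>The greatest entry is a left-to-right maximum, so its prefix is Lyndon and it cannot lie
  after \<open>k\<close>. It cannot lie before \<open>k\<close> either, since \<open>xs ! k\<close>
  is itself a left-to-right maximum.\<close>

lemma represents_prefix_order_greatest:
  fixes w :: "'a::linorder list"
  assumes rep: "represents_prefix_order xs w" and k: "k < length xs"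
    and lu: "lyndon (take (Suc k) w)"
    and max: "\<And>j. k < j \<Longrightarrow> j < length xs \<Longrightarrow> \<not> lyndon (take (Suc j) w)"
    and i: "i < length xs" "i \<noteq> k"
  shows "xs ! i < xs ! k"
proof -
  have dist: "distinct xs"
    using rep by (simp add: represents_prefix_order_def)
  have "Max (set xs) \<in> set xs"
    using k by (intro Max_in) auto
  then obtain j where j: "j < length xs" "xs ! j = Max (set xs)"
    by (metis in_set_conv_nth)
  have less: "xs ! l < xs ! j" if "l < length xs" "l \<noteq> j" for l
  proof -
    have "xs ! l \<le> xs ! j"
      using that j by simp
    moreover have "xs ! l \<noteq> xs ! j"
      using nth_eq_iff_index_eq[OF dist that(1) j(1)] that(2) by simp
    ultimately show ?thesis by simp
  qed
  then have "lyndon (take (Suc j) w)"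
    using lyndon_prefix_iff_left_to_right_maximum[OF rep j(1)] j by auto
  then have "\<not> k < j"
    using max j by blast
  moreover have "\<not> j < k"
    using lyndon_prefix_iff_left_to_right_maximum[OF rep k] lu less[of k] k
    by (metis less_asym less_irrefl)
  ultimately have "j = k"
    by simp
  with less i show ?thesis by simp
qed

text \<open>The sequence \<open>xs\<close> is kept arbitrary for the induction: the entries after
  the maximum are ordered like the prefixes of the right factor but need not form its standard
  permutation.\<close>

lemma left_lyndon_tree_eq_complete_with:
  fixes w :: "'a::linorder list"
  assumes "lyndon w" and "represents_prefix_order xs w"
  shows "left_lyndon_tree w = complete_with (decreasing_tree xs) w"
  using assms
proof (induction w arbitrary: xs rule: length_induct)
  case (1 w)
  note lw = \<open>lyndon w\<close> and rep = \<open>represents_prefix_order xs w\<close>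
  have len: "length w = Suc (length xs)"
    using rep by (simp add: represents_prefix_order_def)
  show ?case
  proof (cases "xs = []")
    case True
    with len obtain a where "w = [a]"
      by (auto simp: length_Suc_conv)
    with True show ?thesis by simp
  next
    case False
    then have len2: "length w \<ge> 2"
      using len by (cases xs) auto
    \<comment> \<open>Index \<open>k\<close> belongs to the prefix of length \<open>Suc k\<close>,
      here the longest proper Lyndon prefix.\<close>
    define k where "k = left_std_length w - 1"
    define u v where "u = take (Suc k) w" and "v = drop (Suc k) w"
    have Sk: "Suc k = left_std_length w" "k < length xs"
      using left_std_length_bounds[OF len2] len by (auto simp: k_def)
    have w: "w = u @ v" and lu: "lyndon u" and luk: "length u = Suc k" and v: "v \<noteq> []"
      using left_std_length_props(1)[OF len2] Sk len by (simp_all add: u_def v_def)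
    have max: "\<not> lyndon (take (Suc j) w)" if "k < j" "j < length xs" for j
      using left_std_length_props(2)[OF len2, of "Suc j"] that Sk len by simp
    define l m r where "l = take k xs" and "m = xs ! k" and "r = drop (Suc k) xs"
    have xs: "xs = l @ m # r" and ll: "length l = k"
      using Sk id_take_nth_drop[of k xs] by (simp_all add: l_def m_def r_def)
    have "y < m" if y: "y \<in> set l \<union> set r" for y
    proof -
      have "y \<in> set xs" "y \<noteq> m"
        using y rep by (auto simp: xs represents_prefix_order_def)
      then obtain i where "i < length xs" "y = xs ! i" "i \<noteq> k"
        by (metis in_set_conv_nth m_def)
      then show ?thesis
        using represents_prefix_order_greatest[OF rep Sk(2) _ max] lu by (simp add: u_def m_def)
    qed
    then have tree: "decreasing_tree xs = \<langle>decreasing_tree l, m, decreasing_tree r\<rangle>"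
      unfolding xs by (rule decreasing_tree_split)
    have "\<not> lyndon (u @ y)" if "v = y @ z" "y \<noteq> []" "z \<noteq> []" for y z
    proof -
      have "u @ y = take (Suc (k + length y)) w"
        using luk w that by simp
      moreover have "\<not> lyndon (take (Suc (k + length y)) w)"
        using that len luk w by (intro max) (auto simp flip: length_greater_0_conv)
      ultimately show ?thesis by simp
    qed
    then obtain x b c z where x: "v = x @ [c]" "w = x @ b # z" "b < c"
      using left_standard_shape[of u v] lw lu v unfolding w by metis
    have "lyndon v"
      using lyndon_right_factor[OF lw x(2,3)] x(1) by simp
    moreover have "represents_prefix_order r v"
      unfolding x(1) using rep lw x w xs ll luk
      by (intro represents_prefix_order_right[of l m r u x c "b # z"]) auto
    ultimately have "left_lyndon_tree v = complete_with (decreasing_tree r) v"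
      using w luk by (intro 1(1)[rule_format]) auto
    moreover have "represents_prefix_order l u"
      using rep ll luk unfolding w xs by (intro represents_prefix_order_left[of l m r u v]) simp_all
    then have "left_lyndon_tree u = complete_with (decreasing_tree l) u"
      using w v lu by (intro 1(1)[rule_format]) auto
    \<comment> \<open>The left subtree has \<open>length l + 1 = Suc k\<close> leaves, so
      \<open>complete_with\<close> cuts \<open>w\<close> exactly after \<open>u\<close>.\<close>
    ultimately show ?thesis
      using left_lyndon_tree_Branch[OF len2] Sk ll
      by (simp add: tree size1_decreasing_tree u_def v_def)
  qed
qed

section \<open>The order of the entries of the prefix standard permutation\<close>

lemma is_prefix_std_perm: "is_prefix_std_perm w (prefix_std_perm w)"
  unfolding prefix_std_perm_def using ex1_prefix_std_perm by (rule theI')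

text \<open>Sortedness along the inverse permutation gives one direction; the other follows since
  the permutation is injective and \<open>prec\<close> is irreflexive and transitive.\<close>

lemma prefix_std_perm_less_iff:
  fixes w :: "'a::linorder list"
  assumes "i \<in> {1..length w}" and "j \<in> {1..length w}"
  shows "prefix_std_perm w i < prefix_std_perm w j \<longleftrightarrow> prec (take i w) (take j w)"
proof -
  let ?\<sigma> = "prefix_std_perm w"
  have perm: "?\<sigma> permutes {1..length w}"
    and sorted: "sorted_wrt prec (map (\<lambda>i. take (inv ?\<sigma> i) w) [1..<Suc (length w)])"
    using is_prefix_std_perm[of w] by (simp_all only: is_prefix_std_perm_def)
  have less: "prec (take i w) (take j w)"
    if "i \<in> {1..length w}" "j \<in> {1..length w}" "?\<sigma> i < ?\<sigma> j" for i j
  proof -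
    have "?\<sigma> i \<in> {1..length w}" "?\<sigma> j \<in> {1..length w}"
      using that permutes_in_image[OF perm] by blast+
    then show ?thesis
      using sorted_wrt_nth_less[OF sorted, of "?\<sigma> i - 1" "?\<sigma> j - 1"] that
        permutes_inverses[OF perm] by (auto simp del: upt_Suc)
  qed
  show ?thesis
    using less[OF assms] less[OF assms(2,1)] prec_irrefl prec_trans permutes_inj[OF perm]
    by (metis injD linorder_neqE_nat)
qed

text \<open>Here \<open>prec_append_iff\<close> trades infinite powers for finite words. The list
  ends before \<open>length w\<close>, which drops the entry of \<open>w\<close> itself.\<close>

lemma represents_prefix_std_perm:
  assumes "w \<noteq> []"
  shows "represents_prefix_order (map (prefix_std_perm w) [1..<length w]) w"
  unfolding represents_prefix_order_def
proof (intro conjI allI impI)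
  have "inj (prefix_std_perm w)"
    using is_prefix_std_perm[of w] permutes_inj unfolding is_prefix_std_perm_def by blast
  then show "distinct (map (prefix_std_perm w) [1..<length w])"
    by (auto simp: distinct_map intro: inj_on_subset)
  show "length w = Suc (length (map (prefix_std_perm w) [1..<length w]))"
    using assms by simp
  fix y s t assume w: "w = y @ s @ t \<and> y \<noteq> [] \<and> s \<noteq> [] \<and> t \<noteq> []"
  let ?xs = "map (prefix_std_perm w) [1..<length w]"
  \<comment> \<open>The list starts with the prefix of length 1, whence the index shift.\<close>
  have nth: "?xs ! (length p - 1) = prefix_std_perm w (length p)"
    if "p \<noteq> []" "length p < length w" for p :: "'a list"
    using that by (cases "length p") auto
  have "?xs ! (length y - 1) < ?xs ! (length (y @ s) - 1) \<longleftrightarrow>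
      prefix_std_perm w (length y) < prefix_std_perm w (length (y @ s))"
    using w by (subst (1 2) nth) auto
  also have "\<dots> \<longleftrightarrow> prec (take (length y) w) (take (length (y @ s)) w)"
    using w by (intro prefix_std_perm_less_iff) (auto simp: Suc_le_eq)
  also have "\<dots> \<longleftrightarrow> y @ s < s @ y"
    using w prec_append_iff[of y s] by simp
  finally show "?xs ! (length y - 1) < ?xs ! (length (y @ s) - 1) \<longleftrightarrow> y @ s < s @ y" .
qed

theorem theorem7:
  fixes w :: "'a::linorder list"
  assumes "lyndon w"
  shows "left_lyndon_tree w = left_cartesian_tree w"
proof -
  have "w \<noteq> []"
    using assms by (simp add: lyndon_def)
  \<comment> \<open>For a single letter the list of entries is empty, and completing the empty tree
    agrees with the separate clause of \<open>left_cartesian_tree\<close>.\<close>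
  then show ?thesis
    using left_lyndon_tree_eq_complete_with[OF assms represents_prefix_std_perm]
    by (auto simp: left_cartesian_tree_def)
qed

end
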